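(* Let $\chi\ge 2$ be an integer, let $\varepsilon>0$ and $c>0$, and let $G$ be a finite comparability graph. If $G$ is $\varepsilon$-far from being $K_\chi$-free, then a random subset of $\left\lceil\frac{4\log(\chi)+4c+1}{2\varepsilon}\right\rceil$ vertices of $G$ chosen independently and uniformly at random contains a copy of $K_\chi$ with probability at least $1-e^{-c}$.
   Context: Graphs are simple and undirected. The comparability graph of a poset $(P,\prec)$ (where $\prec$ is anti-reflexive and transitive) is the graph with vertex set $P$ in which $x,y$ are adjacent iff $x\prec y$ or $y\prec x$; a comparability graph is a graph arising in this way from some poset. $K_\chi$ is the complete graph on $\chi$ vertices; a graph is $K_\chi$-free if it has no subgraph isomorphic to $K_\chi$, and a set of vertices contains a copy of $K_\chi$ if it contains $\chi$ pairwise adjacent vertices. $G$ is $\varepsilon$-far from being $K_\chi$-free if no graph $G'$ on the vertex set $V(G)$ that differs from $G$ by at most $\varepsilon|V(G)|^2$ edges is $K_\chi$-free. $\log$ is the natural logarithm. The random subset is the set of vertices obtained from the stated number of independent, uniformly distributed draws from $V(G)$ (a vertex may be drawn more than once). *)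

theory Defs
  imports "HOL-Probability.Probability"
begin

text \<open>Undirected edges are two-element sets, so that each edge is counted once.\<close>

record 'a ugraph =
  verts :: "'a set"
  edges :: "'a set set"

definition simple_graph :: "'a ugraph \<Rightarrow> bool" where
  "simple_graph G \<longleftrightarrow> (\<forall>e \<in> edges G. e \<subseteq> verts G \<and> card e = 2)"

definition adjacent :: "'a ugraph \<Rightarrow> 'a \<Rightarrow> 'a \<Rightarrow> bool" where
  "adjacent G x y \<longleftrightarrow> {x, y} \<in> edges G"

definition subgraph :: "'a ugraph \<Rightarrow> 'a ugraph \<Rightarrow> bool" where
  "subgraph H G \<longleftrightarrow> simple_graph H \<and> verts H \<subseteq> verts G \<and> edges H \<subseteq> edges G"

definition isomorphic :: "'a ugraph \<Rightarrow> 'b ugraph \<Rightarrow> bool" where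
  "isomorphic G H \<longleftrightarrow>
    (\<exists>f. bij_betw f (verts G) (verts H) \<and>
         (\<forall>x \<in> verts G. \<forall>y \<in> verts G. adjacent G x y \<longleftrightarrow> adjacent H (f x) (f y)))"

definition complete_graph :: "nat \<Rightarrow> nat ugraph" where
  "complete_graph n = \<lparr>verts = {..<n}, edges = {e. e \<subseteq> {..<n} \<and> card e = 2}\<rparr>"

definition clique_free :: "nat \<Rightarrow> 'a ugraph \<Rightarrow> bool" where
  "clique_free n G \<longleftrightarrow> \<not> (\<exists>H. subgraph H G \<and> isomorphic H (complete_graph n))"

definition contains_clique :: "nat \<Rightarrow> 'a ugraph \<Rightarrow> 'a set \<Rightarrow> bool" where
  "contains_clique n G S \<longleftrightarrow> (\<exists>K \<subseteq> S. card K = n \<and> pairwise (adjacent G) K)"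

definition far_from_clique_free :: "real \<Rightarrow> nat \<Rightarrow> 'a ugraph \<Rightarrow> bool" where
  "far_from_clique_free \<epsilon> n G \<longleftrightarrow>
    \<not> (\<exists>G'. simple_graph G' \<and> verts G' = verts G \<and>
            real (card (sym_diff (edges G) (edges G'))) \<le> \<epsilon> * real (card (verts G)) ^ 2 \<and>
            clique_free n G')"

definition comparability_graph_of :: "'a set \<Rightarrow> ('a \<Rightarrow> 'a \<Rightarrow> bool) \<Rightarrow> 'a ugraph" where
  "comparability_graph_of P r =
    \<lparr>verts = P, edges = {{x, y} | x y. x \<in> P \<and> y \<in> P \<and> (r x y \<or> r y x)}\<rparr>"

definition comparability_graph :: "'a ugraph \<Rightarrow> bool" where
  "comparability_graph G \<longleftrightarrow>
    (\<exists>P r. irreflp_on P r \<and> transp_on P r \<and> G = comparability_graph_of P r)"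

text \<open>
  The set of vertices obtained from m independent uniform draws with replacement; the
  vertex set is meant to be finite and nonempty, since \<^const>\<open>pmf_of_set\<close> is unspecified
  otherwise. The second argument of \<^const>\<open>Pi_pmf\<close> is only the value outside the index set.
\<close>

definition random_vertex_set :: "nat \<Rightarrow> 'a ugraph \<Rightarrow> 'a set pmf" where
  "random_vertex_set m G =
    map_pmf (\<lambda>\<omega>. \<omega> ` {..<m}) (Pi_pmf {..<m} undefined (\<lambda>_. pmf_of_set (verts G)))"

end

theory Submission
  imports Defs
begin

text \<open>
  Split the vertices of a poset on \<open>n\<close> points into levels, from the bottom up: a vertex keeps
  the highest level occurring below it as long as fewer than \<open>t\<close> of its predecessors lie on that
  level, and moves up by one as soon as there are \<open>t\<close> of them. Then few edges join vertices
  of equal level, while every vertex above the bottom level has at least \<open>t\<close> predecessors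
  exactly one level lower (\<open>level_function_exists\<close>). Take \<open>t = \<lceil>\<epsilon> n / 2\<rceil>\<close>. Deleting the
  edges inside levels costs at most \<open>\<epsilon> n\<^sup>2 / 2\<close>; if fewer than \<open>t\<close> vertices had
  level at least \<open>k - 1\<close> (counting from \<open>0\<close>), deleting all edges into them would cost at most as
  much again, and the remaining graph would be properly coloured by the levels \<open>0, \<dots>, k - 2\<close>,
  hence have no \<open>k\<close>-clique. So in a graph that is \<open>\<epsilon>\<close>-far from being clique-free the top of
  the level structure is large (\<open>many_vertices_of_high_level\<close>). Then level \<open>k - 1\<close> itself has at
  least \<open>t\<close> vertices, since a single vertex on level \<open>k\<close> already forces that many below it.

  Now search the sample for a chain, descending from level \<open>k - 1\<close> to level \<open>0\<close>. Each step
  needs a draw in a target set of at least \<open>t\<close> vertices on the next level, and this set depends on the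
  vertex reached so far. One step fails with probability at most \<open>(1 - t / n)\<^sup>m\<close> for \<open>m\<close>
  draws, exactly as for a fixed target, because the choice of the target looks only at draws
  that fall in higher levels (\<open>card_missing_dependent_target\<close>). All \<open>k\<close> steps can therefore use
  the same \<open>m\<close> draws, and a union bound gives failure probability at most
  \<open>k (1 - \<epsilon> / 2)\<^sup>m \<le> k exp (- \<epsilon> m / 2) \<le> exp (- c)\<close>. The logarithm of \<open>k\<close> in the sample
  size is the price of this union bound.
\<close>

section \<open>A level function on a finite poset\<close>

text \<open>
  The levels are assigned along a linear extension, here by adding a maximal vertex \<open>v\<close> to a poset
  that already has levels. The delicate case is a vertex \<open>v\<close> that stays on the highest level
  \<open>h\<close> seen below it: its \<open>t\<close> predecessors on level \<open>h - 1\<close> are inherited, by transitivity, from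
  any predecessor \<open>w\<close> on level \<open>h\<close>. Counting predecessors \<^emph>\<open>exactly\<close> one level lower,
  not merely at least that high, is what later keeps the target of each step of the search apart
  from the draws that determine it.
\<close>

lemma level_function_exists:
  fixes r :: "'a \<Rightarrow> 'a \<Rightarrow> bool" and t :: nat
  assumes "finite P" and "irreflp_on P r" and "transp_on P r" and "t > 0"
  shows "\<exists>l :: 'a \<Rightarrow> nat.
    (\<forall>x\<in>P. \<forall>y\<in>P. r x y \<longrightarrow> l x \<le> l y) \<and>
    (\<forall>y\<in>P. card {x\<in>P. r x y \<and> l x = l y} < t) \<and>
    (\<forall>y\<in>P. \<forall>j. l y = Suc j \<longrightarrow> t \<le> card {x\<in>P. r x y \<and> l x = j})"
  using assms(1-3)
proof (induction "card P" arbitrary: P)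
  case 0
  then show ?case by simp
next
  case (Suc n)
  have asym: "asymp_on P r"
    using Suc.prems by (metis asymp_on_def irreflp_on_def transp_on_def)
  have "P \<noteq> {}"
    using Suc.hyps(2) by auto
  then obtain v where v: "v \<in> P" and max: "\<And>x. x \<in> P \<Longrightarrow> \<not> r v x"
    using Finite_Set.bex_max_element[OF Suc.prems(1) asym Suc.prems(3)] asym
      Suc.prems(2) by (metis irreflp_on_def)
  define Q where "Q = P - {v}"
  have P: "P = insert v Q" and vQ: "v \<notin> Q" and finQ: "finite Q"
    using v Suc.prems(1) by (auto simp: Q_def)
  have "n = card Q"
    using Suc.hyps(2) P vQ finQ by simp
  moreover have "irreflp_on Q r" "transp_on Q r"
    using Suc.prems(2,3) P by (blast intro: irreflp_on_subset transp_on_subset)+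
  ultimately obtain l :: "'a \<Rightarrow> nat" where
    mono: "\<And>x y. x \<in> Q \<Longrightarrow> y \<in> Q \<Longrightarrow> r x y \<Longrightarrow> l x \<le> l y" and
    few: "\<And>y. y \<in> Q \<Longrightarrow> card {x\<in>Q. r x y \<and> l x = l y} < t" and
    many: "\<And>y j. y \<in> Q \<Longrightarrow> l y = Suc j \<Longrightarrow> t \<le> card {x\<in>Q. r x y \<and> l x = j}"
    using Suc.hyps(1)[of Q] finQ by blast
  have nv: "\<not> r v v"
    using max v by blast
  define B where "B = {x\<in>Q. r x v}"
  have finB: "finite B"
    using finQ by (simp add: B_def)
  \<comment> \<open>It suffices to give \<open>v\<close> a level, since \<open>v\<close> lies below nothing.\<close>
  have extend: ?case
    if up: "\<And>x. x \<in> B \<Longrightarrow> l x \<le> h" and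
       few_h: "card {x\<in>B. l x = h} < t" and
       many_h: "\<And>j. h = Suc j \<Longrightarrow> t \<le> card {x\<in>B. l x = j}" for h
  proof -
    let ?l = "l(v := h)"
    have below_Q: "{x\<in>P. r x y \<and> ?l x = j} = {x\<in>Q. r x y \<and> l x = j}" if "y \<in> Q" for y j
      using that max[of y] vQ by (auto simp: P)
    have below_v: "{x\<in>P. r x v \<and> ?l x = j} = {x\<in>B. l x = j}" for j
      using nv vQ by (auto simp: P B_def)
    have "\<forall>x\<in>P. \<forall>y\<in>P. r x y \<longrightarrow> ?l x \<le> ?l y"
      using mono up max nv vQ by (auto simp: P B_def)
    moreover have "card {x\<in>P. r x y \<and> ?l x = ?l y} < t" if "y \<in> P" for y
    proof (cases "y = v")
      case True
      then show ?thesis using few_h below_v[of h] by simp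
    next
      case False
      then have "y \<in> Q" using that by (simp add: P)
      then show ?thesis using few[of y] below_Q[of y "l y"] False by simp
    qed
    moreover have "t \<le> card {x\<in>P. r x y \<and> ?l x = j}" if "y \<in> P" "?l y = Suc j" for y j
    proof (cases "y = v")
      case True
      then have "h = Suc j" using that by simp
      then show ?thesis unfolding True below_v by (rule many_h)
    next
      case False
      then have "y \<in> Q" using that by (simp add: P)
      then show ?thesis using many[of y j] below_Q[of y j] False that by simp
    qed
    ultimately show ?thesis by blast
  qed
  show ?case
  proof (cases "B = {}")
    case True
    show ?thesis by (rule extend[of 0]) (use True \<open>t > 0\<close> in auto)
  next
    case False
    define h where "h = Max (l ` B)"
    have h: "\<And>x. x \<in> B \<Longrightarrow> l x \<le> h" and "h \<in> l ` B"
      using False finB by (auto simp: h_def)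
    then obtain w where w: "w \<in> B" "l w = h" by auto
    show ?thesis
    proof (cases "card {x\<in>B. l x = h} < t")
      case True
      have "t \<le> card {x\<in>B. l x = j}" if "h = Suc j" for j
      proof -
        have wQ: "w \<in> Q" "r w v"
          using w by (auto simp: B_def)
        have "r x v" if "x \<in> Q" "r x w" for x
          using that wQ v Suc.prems(3) unfolding P transp_on_def by blast
        then have "{x\<in>Q. r x w \<and> l x = j} \<subseteq> {x\<in>B. l x = j}"
          by (auto simp: B_def)
        moreover have "t \<le> card {x\<in>Q. r x w \<and> l x = j}"
          using many wQ w that by simp
        moreover have "finite {x\<in>B. l x = j}"
          using finB by simp
        ultimately show ?thesis
          by (meson card_mono order_trans)
      qed
      then show ?thesis
        using extend[of h] h True by blast
    next
      case False
      have "{x\<in>B. l x = Suc h} = {}"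
        using h by force
      then have "card {x\<in>B. l x = Suc h} < t"
        using \<open>t > 0\<close> by (metis card.empty)
      then show ?thesis
        using extend[of "Suc h"] h False by (simp add: le_SucI)
    qed
  qed
qed

section \<open>Being far from clique-free makes a high level large\<close>

lemma clique_of_not_clique_free:
  assumes "\<not> clique_free n G"
  shows "\<exists>K\<subseteq>verts G. card K = n \<and> pairwise (adjacent G) K"
proof -
  obtain H f where H: "verts H \<subseteq> verts G" "edges H \<subseteq> edges G"
    and bij: "bij_betw f (verts H) {..<n}"
    and adj: "\<And>x y. x \<in> verts H \<Longrightarrow> y \<in> verts H \<Longrightarrow>
      adjacent H x y \<longleftrightarrow> adjacent (complete_graph n) (f x) (f y)"
    using assms by (auto simp: clique_free_def subgraph_def isomorphic_def complete_graph_def)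
  have "adjacent G x y" if "x \<in> verts H" "y \<in> verts H" "x \<noteq> y" for x y
  proof -
    have "f x \<noteq> f y" "f x < n" "f y < n"
      using that bij by (auto simp: bij_betw_def inj_on_def)
    then have "adjacent H x y"
      using adj[OF that(1,2)] by (simp add: adjacent_def complete_graph_def)
    then show ?thesis
      using H(2) by (auto simp: adjacent_def)
  qed
  moreover have "card (verts H) = n"
    using bij_betw_same_card[OF bij] by simp
  ultimately show ?thesis
    using H(1) by (auto simp: pairwise_def)
qed

text \<open>
  If few vertices had level at least \<open>k - 1\<close>, then keeping only the edges between distinct levels
  below \<open>k - 1\<close> would destroy all \<open>k\<close>-cliques, as the level is a proper colouring of what is
  left with \<open>k - 1\<close> colours. Each vertex is the upper endpoint of at most \<open>t - 1\<close> deleted edges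
  inside its level, and at most \<open>t - 1\<close> vertices lose all their downward edges; this is the
  origin of the factor \<open>2\<close> in the last assumption.
\<close>

lemma many_vertices_of_high_level:
  fixes l :: "'a \<Rightarrow> nat" and t :: nat
  assumes far: "far_from_clique_free \<epsilon> k (comparability_graph_of P r)"
    and "finite P" and "irreflp_on P r" and "k \<ge> 2"
    and mono: "\<And>x y. x \<in> P \<Longrightarrow> y \<in> P \<Longrightarrow> r x y \<Longrightarrow> l x \<le> l y"
    and few: "\<And>y. y \<in> P \<Longrightarrow> card {x\<in>P. r x y \<and> l x = l y} < t"
    and t: "2 * real (t - 1) \<le> \<epsilon> * real (card P)"
  shows "t \<le> card {y\<in>P. k - 1 \<le> l y}"
proof (rule ccontr)
  define U where "U = {y\<in>P. k - 1 \<le> l y}"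
  assume "\<not> ?thesis"
  then have U: "card U \<le> t - 1" by (simp add: U_def)
  let ?G = "comparability_graph_of P r"
  define G' where "G' = \<lparr>verts = P,
    edges = {{x, y} | x y. x \<in> P \<and> y \<in> P \<and> r x y \<and> l x < l y \<and> l y < k - 1}\<rparr>"
  have irr: "\<And>x. x \<in> P \<Longrightarrow> \<not> r x x"
    using assms(3) by (auto simp: irreflp_on_def)
  have simple: "simple_graph G'"
    using irr by (auto simp: simple_graph_def G'_def card_2_iff)
  have free: "clique_free k G'"
  proof (rule ccontr)
    assume "\<not> clique_free k G'"
    then obtain K where K: "card K = k" "pairwise (adjacent G') K"
      using clique_of_not_clique_free by blast
    have adj: "l x \<noteq> l y \<and> l x < k - 1" if "x \<in> K" "y \<in> K" "x \<noteq> y" for x y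
    proof -
      have "{x, y} \<in> edges G'"
        using K(2) that by (auto simp: pairwise_def adjacent_def)
      then obtain a b where "{x, y} = {a, b}" "l a < l b" "l b < k - 1"
        by (auto simp: G'_def)
      then show ?thesis
        by (auto simp: doubleton_eq_iff)
    qed
    have "l x < k - 1" if x: "x \<in> K" for x
    proof -
      have "K \<noteq> {x}" using K(1) assms(4) by auto
      then obtain y where "y \<in> K" "y \<noteq> x" using x by blast
      then show ?thesis using adj x by blast
    qed
    then have "l ` K \<subseteq> {..<k - 1}" by auto
    moreover have "inj_on l K"
      using adj by (auto simp: inj_on_def)
    ultimately have "card K \<le> k - 1"
      using card_inj_on_le[of l K "{..<k - 1}"] by simp
    then show False using K(1) assms(4) by simp
  qed
  \<comment> \<open>Deleted edges, oriented upwards and listed by their upper endpoint.\<close>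
  define S where "S = (SIGMA y:P. {x\<in>P. r x y \<and> l x = l y}) \<union> U \<times> P"
  have finS: "finite S"
    using assms(2) by (auto simp: S_def U_def)
  have "sym_diff (edges ?G) (edges G') \<subseteq> (\<lambda>(y, x). {x, y}) ` S"
  proof
    fix e assume e: "e \<in> sym_diff (edges ?G) (edges G')"
    have "edges G' \<subseteq> edges ?G"
      by (auto simp: G'_def comparability_graph_of_def)
    then have "e \<in> edges ?G" and nG': "e \<notin> edges G'"
      using e by auto
    then obtain x y where xy: "e = {x, y}" "x \<in> P" "y \<in> P" "r x y"
      by (auto simp: comparability_graph_of_def insert_commute)
    then have "\<not> (l x < l y \<and> l y < k - 1)"
      using nG' by (auto simp: G'_def)
    then have "(y, x) \<in> S"
      using mono[of x y] xy by (auto simp: S_def U_def)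
    then show "e \<in> (\<lambda>(y, x). {x, y}) ` S"
      using xy(1) by force
  qed
  then have "card (sym_diff (edges ?G) (edges G')) \<le> card S"
    using finS by (meson card_image_le card_mono finite_imageI order_trans)
  also have "card S \<le> card (SIGMA y:P. {x\<in>P. r x y \<and> l x = l y}) + card (U \<times> P)"
    unfolding S_def by (rule card_Un_le)
  also have "\<dots> = (\<Sum>y\<in>P. card {x\<in>P. r x y \<and> l x = l y}) + card U * card P"
    using assms(2) by (simp add: card_cartesian_product)
  also have "\<dots> \<le> card P * (t - 1) + (t - 1) * card P"
  proof (rule add_mono)
    have "card {x\<in>P. r x y \<and> l x = l y} \<le> t - 1" if "y \<in> P" for y
      using few[OF that] by simp
    then show "(\<Sum>y\<in>P. card {x\<in>P. r x y \<and> l x = l y}) \<le> card P * (t - 1)"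
      using sum_bounded_above[of P _ "t - 1"] by simp
  qed (use U in simp)
  finally have "real (card (sym_diff (edges ?G) (edges G'))) \<le> real (2 * (t - 1) * card P)"
    by (simp only: of_nat_le_iff) (simp add: algebra_simps)
  also have "\<dots> \<le> \<epsilon> * real (card P) ^ 2"
    using mult_right_mono[OF t, of "real (card P)"] by (simp add: power2_eq_square mult_ac)
  finally have "real (card (sym_diff (edges ?G) (edges G'))) \<le> \<epsilon> * real (card (verts ?G)) ^ 2"
    by (simp add: comparability_graph_of_def)
  moreover have "verts G' = verts ?G"
    by (simp add: G'_def comparability_graph_of_def)
  ultimately show False
    using far simple free unfolding far_from_clique_free_def by blast
qed

section \<open>Hitting a target that depends on part of the sample\<close>

text \<open>
  The target \<open>N T\<close> lies outside \<open>A\<close>, but is chosen after seeing the part \<open>T\<close> of the sample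
  that falls in \<open>A\<close>. This gains nothing over a fixed target \<open>N0\<close> of size \<open>s\<close>: for each \<open>T\<close>, map
  \<open>V - A - N T\<close> injectively into \<open>V - A - N0\<close>, and apply that map to the draws outside
  \<open>A\<close>. The draws in \<open>A\<close> are unchanged, so \<open>T\<close> can be read off the result and the map on
  samples is injective; it sends every sample that misses its own target to one that misses \<open>N0\<close>.
  The set \<open>Q\<close> holds those \<open>T\<close> for which a target is defined.
\<close>

lemma card_missing_dependent_target:
  fixes N :: "'a set \<Rightarrow> 'a set" and m s :: nat
  assumes "finite V"
    and target: "\<And>T. T \<in> Q \<Longrightarrow> N T \<subseteq> V - A \<and> s \<le> card (N T)"
  shows "card {\<omega> \<in> {..<m} \<rightarrow>\<^sub>E V. \<omega> ` {..<m} \<inter> A \<in> Q \<and>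
            \<omega> ` {..<m} \<inter> N (\<omega> ` {..<m} \<inter> A) = {}} \<le> (card V - s) ^ m"
    (is "card ?M \<le> _")
proof (cases "Q = {}")
  case True
  then show ?thesis by simp
next
  case False
  then obtain N0 where N0: "N0 \<subseteq> V - A" "card N0 = s"
    using target by (metis ex_in_conv obtain_subset_with_card_n order_trans)
  have "\<exists>\<pi>. \<pi> ` (V - A - N T) \<subseteq> V - A - N0 \<and> inj_on \<pi> (V - A - N T)" if "T \<in> Q" for T
  proof -
    have "card (V - A - N T) \<le> card (V - A - N0)"
      using target[OF that] N0 assms(1)
      by (metis card_Diff_subset diff_le_mono2 finite_Diff finite_subset)
    then show ?thesis
      using assms(1) by (simp add: card_le_inj)
  qed
  then obtain \<pi> where \<pi>: "\<And>T. T \<in> Q \<Longrightarrow> \<pi> T ` (V - A - N T) \<subseteq> V - A - N0"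
      "\<And>T. T \<in> Q \<Longrightarrow> inj_on (\<pi> T) (V - A - N T)"
    by metis
  define seen where "seen \<omega> = \<omega> ` {..<m} \<inter> A" for \<omega> :: "nat \<Rightarrow> 'a"
  define F where "F \<omega> = (\<lambda>i\<in>{..<m}. if \<omega> i \<in> A then \<omega> i else \<pi> (seen \<omega>) (\<omega> i))"
    for \<omega> :: "nat \<Rightarrow> 'a"
  have M: "\<omega> \<in> {..<m} \<rightarrow>\<^sub>E V" "seen \<omega> \<in> Q"
      "\<And>i. i < m \<Longrightarrow> \<omega> i \<notin> A \<Longrightarrow> \<omega> i \<in> V - A - N (seen \<omega>)" if "\<omega> \<in> ?M" for \<omega>
    using that by (auto simp: seen_def)
  have outside: "\<pi> (seen \<omega>) (\<omega> i) \<in> V - A - N0" if "\<omega> \<in> ?M" "i < m" "\<omega> i \<notin> A" for \<omega> i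
    using \<pi>(1)[OF M(2)[OF that(1)]] M(3)[OF that] by blast
  have F_in: "F \<omega> i \<in> A \<longleftrightarrow> \<omega> i \<in> A" if "\<omega> \<in> ?M" "i < m" for \<omega> i
    using outside[OF that] that(2) by (auto simp: F_def)
  have seen_F: "seen (F \<omega>) = seen \<omega>" if "\<omega> \<in> ?M" for \<omega>
  proof -
    have "F \<omega> i = \<omega> i" if "i < m" "\<omega> i \<in> A" for i
      using that by (simp add: F_def)
    moreover have "{i. i < m \<and> F \<omega> i \<in> A} = {i. i < m \<and> \<omega> i \<in> A}"
      using F_in[OF that] by blast
    moreover have "seen \<omega>' = \<omega>' ` {i. i < m \<and> \<omega>' i \<in> A}" for \<omega>'
      by (auto simp: seen_def)
    ultimately show ?thesis
      by (simp cong: image_cong_simp)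
  qed
  have "inj_on F ?M"
  proof (rule inj_onI)
    fix \<omega> \<omega>' assume w: "\<omega> \<in> ?M" "\<omega>' \<in> ?M" and eq: "F \<omega> = F \<omega>'"
    have s: "seen \<omega> = seen \<omega>'"
      using seen_F[OF w(1)] seen_F[OF w(2)] eq by simp
    have "\<omega> i = \<omega>' i" if "i < m" for i
    proof (cases "\<omega> i \<in> A")
      case True
      then have "\<omega>' i \<in> A" using F_in[OF w(1) that] F_in[OF w(2) that] eq by simp
      then show ?thesis
        using True fun_cong[OF eq, of i] that by (simp add: F_def)
    next
      case False
      then have *: "\<omega>' i \<notin> A" using F_in[OF w(1) that] F_in[OF w(2) that] eq by simp
      then have "\<pi> (seen \<omega>) (\<omega> i) = \<pi> (seen \<omega>) (\<omega>' i)"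
        using False fun_cong[OF eq, of i] that s by (simp add: F_def)
      then show ?thesis
        using \<pi>(2)[OF M(2)[OF w(1)]] M(3)[OF w(1) that False] M(3)[OF w(2) that *] s
        by (simp add: inj_on_def)
    qed
    then show "\<omega> = \<omega>'"
      using M(1)[OF w(1)] M(1)[OF w(2)] by (intro PiE_ext) auto
  qed
  moreover have "F ` ?M \<subseteq> {..<m} \<rightarrow>\<^sub>E (V - N0)"
  proof (intro image_subsetI PiE_I)
    fix \<omega> i assume w: "\<omega> \<in> ?M" and "i \<in> {..<m}"
    then show "F \<omega> i \<in> V - N0"
      using outside[OF w, of i] M(1)[OF w] N0(1) by (auto simp: F_def PiE_mem)
  qed (auto simp: F_def)
  moreover have "finite ({..<m} \<rightarrow>\<^sub>E (V - N0))"
    using assms(1) by (simp add: finite_PiE)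
  ultimately have "card ?M \<le> card ({..<m} \<rightarrow>\<^sub>E (V - N0))"
    by (rule card_inj_on_le)
  also have "\<dots> = (card V - s) ^ m"
  proof -
    have "card (V - N0) = card V - s"
      using N0 assms(1) by (metis Diff_subset card_Diff_subset finite_subset order_trans)
    then show ?thesis
      by (simp add: card_PiE)
  qed
  finally show ?thesis .
qed

section \<open>Descending level by level inside the sample\<close>

text \<open>
  The vertices at which the descending search through \<open>D 0, \<dots>, D i\<close> inside \<open>T\<close> can arrive.
  Here \<open>D 0\<close> is the highest level, so that the index grows as the search goes down.
\<close>

fun chain_ends :: "('a \<Rightarrow> 'a \<Rightarrow> bool) \<Rightarrow> (nat \<Rightarrow> 'a set) \<Rightarrow> 'a set \<Rightarrow> nat \<Rightarrow> 'a set" where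
  "chain_ends r D T 0 = T \<inter> D 0"
| "chain_ends r D T (Suc i) = {v \<in> T \<inter> D (Suc i). \<exists>u \<in> chain_ends r D T i. r v u}"

lemma chain_ends_subset: "chain_ends r D T i \<subseteq> T \<inter> D i"
  by (cases i) auto

text \<open>
  A search through \<open>D 0, \<dots>, D i\<close> sees only draws in these sets. This is what lets its endpoint
  serve to choose the next target in \<open>card_missing_dependent_target\<close>.
\<close>

lemma chain_ends_Int:
  "(\<And>j. j \<le> i \<Longrightarrow> D j \<subseteq> A) \<Longrightarrow> chain_ends r D (T \<inter> A) i = chain_ends r D T i"
proof (induction i)
  case 0
  then show ?case by auto
next
  case (Suc i)
  then have "chain_ends r D (T \<inter> A) i = chain_ends r D T i" by simp
  then show ?case using Suc.prems[of "Suc i"] by auto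
qed

lemma chain_of_chain_end:
  assumes "irreflp_on P r" and "transp_on P r" and D: "\<And>j. D j \<subseteq> P"
    and "v \<in> chain_ends r D T i"
  shows "\<exists>K\<subseteq>T \<inter> P. card K = Suc i \<and> v \<in> K \<and> (\<forall>x\<in>K. x \<noteq> v \<longrightarrow> r v x) \<and>
           pairwise (\<lambda>x y. r x y \<or> r y x) K"
  using assms(4)
proof (induction i arbitrary: v)
  case 0
  then show ?case
    using D[of 0] by (intro exI[of _ "{v}"]) (auto simp: pairwise_def)
next
  case (Suc i)
  then obtain u where v: "v \<in> T" "v \<in> P" "r v u" and u: "u \<in> chain_ends r D T i"
    using D by auto
  obtain K where K: "K \<subseteq> T \<inter> P" "card K = Suc i" "u \<in> K" "\<And>x. x \<in> K \<Longrightarrow> x \<noteq> u \<Longrightarrow> r u x"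
      "pairwise (\<lambda>x y. r x y \<or> r y x) K"
    using Suc.IH[OF u] by blast
  have above: "r v x" if "x \<in> K" for x
  proof (cases "x = u")
    case False
    then show ?thesis
      using K(1,3) K(4)[OF that] v that assms(2) unfolding transp_on_def by blast
  qed (use v in simp)
  then have "v \<notin> K"
    using v assms(1) by (auto simp: irreflp_on_def)
  moreover have "finite K"
    using K(2) by (metis card.infinite nat.distinct(1))
  ultimately show ?case
    using K above v
    by (intro exI[of _ "insert v K"]) (auto simp: pairwise_insert)
qed

text \<open>
  A union bound over the steps of the search: if it reaches \<open>D i\<close> but not \<open>D (Suc i)\<close>, then the
  sample misses all predecessors in \<open>D (Suc i)\<close> of one selected endpoint in \<open>D i\<close>. That endpoint is
  determined by the draws in \<open>D 0, \<dots>, D i\<close>, which are disjoint from \<open>D (Suc i)\<close>.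
\<close>

lemma card_samples_without_chain:
  fixes m t :: nat
  assumes "finite V" and D: "\<And>j. D j \<subseteq> V"
    and disj: "\<And>i j. i < j \<Longrightarrow> D i \<inter> D j = {}"
    and start: "t \<le> card (D 0)"
    and step: "\<And>i v. Suc i < k \<Longrightarrow> v \<in> D i \<Longrightarrow> t \<le> card {u \<in> D (Suc i). r u v}"
    and "i < k"
  shows "card {\<omega> \<in> {..<m} \<rightarrow>\<^sub>E V. chain_ends r D (\<omega> ` {..<m}) i = {}} \<le> Suc i * (card V - t) ^ m"
  using assms(6)
proof (induction i)
  case 0
  have "{\<omega> \<in> {..<m} \<rightarrow>\<^sub>E V. chain_ends r D (\<omega> ` {..<m}) 0 = {}} \<subseteq> {..<m} \<rightarrow>\<^sub>E (V - D 0)"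
    by (auto simp: PiE_iff extensional_def)
  then have "card {\<omega> \<in> {..<m} \<rightarrow>\<^sub>E V. chain_ends r D (\<omega> ` {..<m}) 0 = {}}
      \<le> card ({..<m} \<rightarrow>\<^sub>E (V - D 0))"
    using assms(1) by (intro card_mono finite_PiE) auto
  also have "\<dots> = (card V - card (D 0)) ^ m"
    using assms(1) D[of 0] by (subst card_PiE) (auto simp: card_Diff_subset finite_subset)
  also have "\<dots> \<le> Suc 0 * (card V - t) ^ m"
    using start by (simp add: power_mono)
  finally show ?case .
next
  case (Suc i)
  define A where "A = (\<Union>j\<le>i. D j)"
  define N where "N T = {u \<in> D (Suc i). r u (SOME v. v \<in> chain_ends r D T i)}" for T
  define Q where "Q = {T. chain_ends r D T i \<noteq> {}}"
  have ends: "chain_ends r D (T \<inter> A) i = chain_ends r D T i" for T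
    by (rule chain_ends_Int) (auto simp: A_def)
  have chosen: "(SOME v. v \<in> chain_ends r D T i) \<in> chain_ends r D T i" if "T \<in> Q" for T
    using that by (simp add: Q_def some_in_eq)
  have target: "N T \<subseteq> V - A \<and> t \<le> card (N T)" if "T \<in> Q" for T
  proof
    have "D (Suc i) \<inter> A = {}"
      unfolding A_def using disj[of _ "Suc i"] by (blast dest: le_imp_less_Suc)
    then show "N T \<subseteq> V - A"
      using D[of "Suc i"] by (auto simp: N_def)
    show "t \<le> card (N T)"
      unfolding N_def using step[OF Suc.prems] chosen[OF that] chain_ends_subset by fastforce
  qed
  let ?B = "\<lambda>i. {\<omega> \<in> {..<m} \<rightarrow>\<^sub>E V. chain_ends r D (\<omega> ` {..<m}) i = {}}"
  let ?M = "{\<omega> \<in> {..<m} \<rightarrow>\<^sub>E V. \<omega> ` {..<m} \<inter> A \<in> Q \<and> \<omega> ` {..<m} \<inter> N (\<omega> ` {..<m} \<inter> A) = {}}"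
  have "?B (Suc i) \<subseteq> ?B i \<union> ?M"
  proof
    fix \<omega> assume w: "\<omega> \<in> ?B (Suc i)"
    let ?T = "\<omega> ` {..<m}"
    have "?T \<inter> N (?T \<inter> A) = {}" if "?T \<inter> A \<in> Q"
      using w chosen[OF that] unfolding N_def ends by auto
    then show "\<omega> \<in> ?B i \<union> ?M"
      using w by (auto simp: Q_def ends)
  qed
  then have "card (?B (Suc i)) \<le> card (?B i \<union> ?M)"
    using assms(1) by (intro card_mono finite_UnI finite_Collect_conjI disjI1)
      (auto simp: finite_PiE)
  also have "\<dots> \<le> card (?B i) + card ?M"
    by (rule card_Un_le)
  also have "\<dots> \<le> Suc i * (card V - t) ^ m + (card V - t) ^ m"
    using Suc card_missing_dependent_target[OF assms(1) target, of Q] by (intro add_mono) auto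
  finally show ?case by simp
qed

section \<open>The sampling theorem\<close>

lemma prob_random_vertex_set:
  assumes "finite (verts G)" and "verts G \<noteq> {}"
  shows "measure_pmf.prob (random_vertex_set m G) X =
    real (card {\<omega> \<in> {..<m} \<rightarrow>\<^sub>E verts G. \<omega> ` {..<m} \<in> X}) / real (card (verts G)) ^ m"
proof -
  let ?W = "{..<m} \<rightarrow>\<^sub>E verts G"
  have "PiE_dflt {..<m} undefined (\<lambda>_. verts G) = ?W"
    by (auto simp: PiE_dflt_def PiE_iff extensional_def)
  then have "random_vertex_set m G = map_pmf (\<lambda>\<omega>. \<omega> ` {..<m}) (pmf_of_set ?W)"
    using assms by (simp add: random_vertex_set_def Pi_pmf_of_set)
  moreover have "?W \<noteq> {}" "finite ?W"
    using assms by (auto simp: PiE_eq_empty_iff finite_PiE)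
  moreover have "card ?W = card (verts G) ^ m"
    by (simp add: card_PiE)
  moreover have "?W \<inter> (\<lambda>\<omega>. \<omega> ` {..<m}) -` X = {\<omega> \<in> ?W. \<omega> ` {..<m} \<in> X}"
    by auto
  ultimately show ?thesis
    by (simp add: measure_pmf_of_set)
qed

theorem theorem4p4:
  fixes G :: "'a ugraph" and k :: nat and \<epsilon> c :: real
  assumes "k \<ge> 2" and "\<epsilon> > 0" and "c > 0"
    and "finite (verts G)"
    and "comparability_graph G"
    and "far_from_clique_free \<epsilon> k G"
  shows "measure_pmf.prob
           (random_vertex_set (nat \<lceil>(4 * ln (real k) + 4 * c + 1) / (2 * \<epsilon>)\<rceil>) G)
           {S. contains_clique k G S} \<ge> 1 - exp (- c)"
proof -
  define m where "m = nat \<lceil>(4 * ln (real k) + 4 * c + 1) / (2 * \<epsilon>)\<rceil>"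
  obtain P r where irr: "irreflp_on P r" and trans: "transp_on P r"
    and G: "G = comparability_graph_of P r"
    using assms(5) by (auto simp: comparability_graph_def)
  have V: "verts G = P" and finP: "finite P"
    using assms(4) by (auto simp: G comparability_graph_of_def)
  \<comment> \<open>On the empty poset the threshold \<open>1\<close> is admissible, but no vertex exists to meet it.\<close>
  have "P \<noteq> {}"
    using many_vertices_of_high_level[of \<epsilon> k P r "\<lambda>_. 0" 1] assms(1,6) irr G by auto
  define n where "n = card P"
  then have n: "n > 0"
    using finP \<open>P \<noteq> {}\<close> by (simp add: card_gt_0_iff)
  define t where "t = nat \<lceil>\<epsilon> * real n / 2\<rceil>"
  have "0 < \<epsilon> * real n / 2"
    using assms(2) n by simp
  then have t: "0 < t" "\<epsilon> * real n / 2 \<le> real t" "2 * real (t - 1) \<le> \<epsilon> * real (card P)"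
    unfolding t_def n_def by linarith+
  obtain l :: "'a \<Rightarrow> nat" where
    mono: "\<And>x y. x \<in> P \<Longrightarrow> y \<in> P \<Longrightarrow> r x y \<Longrightarrow> l x \<le> l y" and
    few: "\<And>y. y \<in> P \<Longrightarrow> card {x\<in>P. r x y \<and> l x = l y} < t" and
    many: "\<And>y j. y \<in> P \<Longrightarrow> l y = Suc j \<Longrightarrow> t \<le> card {x\<in>P. r x y \<and> l x = j}"
    using level_function_exists[OF finP irr trans t(1)] by blast
  have high: "t \<le> card {y\<in>P. k - 1 \<le> l y}"
    using many_vertices_of_high_level[OF assms(6)[unfolded G] finP irr assms(1) mono few t(3)] .
  define D where "D i = {y\<in>P. l y + i = k - 1}" for i
  have D: "D i \<subseteq> P" for i
    by (auto simp: D_def)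
  have disj: "D i \<inter> D j = {}" if "i < j" for i j
    using that by (auto simp: D_def)
  have start: "t \<le> card (D 0)"
  proof (cases "\<exists>y. y \<in> P \<and> k - 1 < l y")
    case False
    then have "{y\<in>P. k - 1 \<le> l y} = D 0"
      by (auto simp: D_def)
    then show ?thesis
      using high by simp
  next
    case True
    \<comment> \<open>The lowest inhabited level above \<open>k - 1\<close> is \<open>k\<close>, as its predecessor level is inhabited.\<close>
    then obtain y where y: "y \<in> P" "k - 1 < l y"
      and least: "\<And>x. x \<in> P \<Longrightarrow> k - 1 < l x \<Longrightarrow> l y \<le> l x"
      using ex_has_least_nat[of "\<lambda>y. y \<in> P \<and> k - 1 < l y" _ l] by blast
    obtain j where j: "l y = Suc j"
      using y(2) by (cases "l y") auto
    have below: "t \<le> card {x\<in>P. r x y \<and> l x = j}"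
      using many[OF y(1) j] .
    then have "{x\<in>P. r x y \<and> l x = j} \<noteq> {}"
      using t(1) by (metis card.empty not_le)
    then have "j = k - 1"
      using least y(2) j by fastforce
    then have "{x\<in>P. r x y \<and> l x = j} \<subseteq> D 0"
      by (auto simp: D_def)
    then have "card {x\<in>P. r x y \<and> l x = j} \<le> card (D 0)"
      using finP finite_subset[OF D] by (intro card_mono)
    then show ?thesis
      using below by simp
  qed
  have step: "t \<le> card {u \<in> D (Suc i). r u v}" if "Suc i < k" "v \<in> D i" for i v
  proof -
    have "l v = Suc (k - 2 - i)" and "v \<in> P"
      using that by (auto simp: D_def)
    moreover have "{u \<in> D (Suc i). r u v} = {u\<in>P. r u v \<and> l u = k - 2 - i}"
      using that(1) by (auto simp: D_def)
    ultimately show ?thesis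
      using many by simp
  qed
  let ?W = "{..<m} \<rightarrow>\<^sub>E P"
  let ?bad = "{\<omega> \<in> ?W. chain_ends r D (\<omega> ` {..<m}) (k - 1) = {}}"
  let ?good = "{\<omega> \<in> ?W. contains_clique k G (\<omega> ` {..<m})}"
  have card_bad: "card ?bad \<le> k * (n - t) ^ m"
    using card_samples_without_chain[where V=P and D=D and k=k and t=t and r=r and m=m and i="k - 1",
        OF finP D disj start step] assms(1)
    by (simp add: n_def)
  have "?W - ?bad \<subseteq> ?good"
  proof
    fix \<omega> assume w: "\<omega> \<in> ?W - ?bad"
    then obtain v where "v \<in> chain_ends r D (\<omega> ` {..<m}) (k - 1)"
      by blast
    from chain_of_chain_end[OF irr trans D this]
    obtain K where K: "K \<subseteq> \<omega> ` {..<m} \<inter> P" "card K = Suc (k - 1)"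
        "pairwise (\<lambda>x y. r x y \<or> r y x) K"
      by blast
    have "pairwise (adjacent G) K"
      using K(1,3) unfolding pairwise_def adjacent_def G comparability_graph_of_def
      by simp blast
    then show "\<omega> \<in> ?good"
      using w K(1,2) assms(1) by (auto simp: contains_clique_def)
  qed
  moreover have finW: "finite ?W"
    using finP by (simp add: finite_PiE)
  ultimately have "card (?W - ?bad) \<le> card ?good"
    by (intro card_mono) auto
  moreover have "card (?W - ?bad) = card ?W - card ?bad"
    using finW by (intro card_Diff_subset) auto
  moreover have "card ?W = n ^ m"
    by (simp add: card_PiE n_def)
  ultimately have "n ^ m \<le> card ?good + k * (n - t) ^ m"
    using card_bad by linarith
  then have "real (n ^ m) \<le> real (card ?good + k * (n - t) ^ m)"
    by (simp only: of_nat_le_iff)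
  then have "1 \<le> (real (card ?good) + real k * real (n - t) ^ m) / real n ^ m"
    using n by simp
  then have "1 - real k * (real (n - t) / real n) ^ m \<le> real (card ?good) / real n ^ m"
    by (simp add: add_divide_distrib power_divide)
  moreover have "real k * (real (n - t) / real n) ^ m \<le> exp (- c)"
  proof -
    have "t \<le> n"
      using start card_mono[OF finP D[of 0]] by (simp add: n_def)
    then have "real (n - t) / real n = 1 - real t / real n"
      using n by (simp add: of_nat_diff diff_divide_distrib)
    also have "\<dots> \<le> 1 - \<epsilon> / 2"
      using t(2) n by (simp add: field_simps)
    also have "\<dots> \<le> exp (- (\<epsilon> / 2))"
      using exp_ge_add_one_self[of "- (\<epsilon> / 2)"] by simp
    finally have "(real (n - t) / real n) ^ m \<le> exp (- (\<epsilon> / 2)) ^ m"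
      by (intro power_mono) auto
    also have "\<dots> = exp (- (\<epsilon> / 2 * real m))"
      by (simp add: exp_of_nat_mult[symmetric] mult_ac)
    also have "\<dots> \<le> exp (- c - ln (real k))"
    proof -
      have "(4 * ln (real k) + 4 * c + 1) / (2 * \<epsilon>) \<le> real m"
        unfolding m_def by linarith
      then have "4 * ln (real k) + 4 * c + 1 \<le> real m * (2 * \<epsilon>)"
        using assms(2) by (simp add: pos_divide_le_eq)
      then show ?thesis
        by (simp add: algebra_simps)
    qed
    also have "\<dots> = exp (- c) / real k"
      using assms(1) by (simp add: exp_diff)
    finally show ?thesis
      using assms(1) by (simp add: field_simps)
  qed
  ultimately have "1 - exp (- c) \<le> real (card ?good) / real n ^ m"
    by linarith
  then show ?thesis
    using prob_random_vertex_set[of G m "{S. contains_clique k G S}"] \<open>P \<noteq> {}\<close> finP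
    by (simp add: V n_def m_def)
qed

end
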